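(* Let $\mu$ be a good probability measure on a non-compact locally compact Cantor set $X$. Extend $\mu$ to the Alexandroff (one-point) compactification $\omega X$ by giving the added point measure zero. Then $\mu$ is good on $\omega X$ if and only if $1 \in G(S(\mu|_X))$, where $\mu|_X$ is the original measure on $X$.
   Context: A non-compact locally compact Cantor set is a non-compact locally compact metrizable space with no isolated points and with a countable basis of compact open sets; its one-point compactification $\omega X$ is a Cantor set (a non-empty zero-dimensional compact perfect metric space). All measures are Borel, full (every non-empty open set has positive measure) and non-atomic. The compact open values set of a measure $\mu$ on $X$ is $S(\mu)=\{\mu(U): U \text{ compact open in } X,\ \mu(U)<\infty\}$, and $G(S(\mu))$ is the additive subgroup of $\mathbb{R}$ generated by $S(\mu)$. A full non-atomic finite Borel measure $\mu$ on a locally compact Cantor set $Z$ (compact or non-compact) is good if for all compact open $U,V\subset Z$ with $\mu(U)<\mu(V)$ there is a compact open $W\subset V$ with $\mu(W)=\mu(U)$. *)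

theory Defs
  imports
    "HOL-Probability.Probability"
    "HOL-Computational_Algebra.Group_Closure"
begin

definition noncompact_lc_cantor :: "'a topology \<Rightarrow> bool" where
  "noncompact_lc_cantor X \<longleftrightarrow>
     metrizable_space X \<and> locally_compact_space X \<and> \<not> compact_space X \<and>
     (\<forall>x \<in> topspace X. \<not> openin X {x}) \<and>
     (\<exists>\<B>. countable \<B> \<and> (\<forall>V \<in> \<B>. compactin X V \<and> openin X V) \<and>
          (\<forall>U x. openin X U \<and> x \<in> U \<longrightarrow> (\<exists>V \<in> \<B>. x \<in> V \<and> V \<subseteq> U)))"

text \<open>The type-class constant \<open>borel\<close> does not apply to spaces given as values of
  type \<open>'a topology\<close>, such as \<open>Alexandroff_compactification X\<close>.\<close>

definition borel_space_of :: "'a topology \<Rightarrow> 'a measure" where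
  "borel_space_of X = sigma (topspace X) {U. openin X U}"

definition borel_measure_on :: "'a topology \<Rightarrow> 'a measure \<Rightarrow> bool" where
  "borel_measure_on X M \<longleftrightarrow> space M = topspace X \<and> sets M = sets (borel_space_of X)"

definition full_measure_on :: "'a topology \<Rightarrow> 'a measure \<Rightarrow> bool" where
  "full_measure_on X M \<longleftrightarrow> (\<forall>U. openin X U \<and> U \<noteq> {} \<longrightarrow> emeasure M U > 0)"

definition measure_atom :: "'a measure \<Rightarrow> 'a set \<Rightarrow> bool" where
  "measure_atom M A \<longleftrightarrow> A \<in> sets M \<and> emeasure M A > 0 \<and>
     (\<forall>B \<in> sets M. B \<subseteq> A \<and> emeasure M B < emeasure M A \<longrightarrow> emeasure M B = 0)"

definition non_atomic :: "'a measure \<Rightarrow> bool" where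
  "non_atomic M \<longleftrightarrow> (\<nexists>A. measure_atom M A)"

definition compact_open_in :: "'a topology \<Rightarrow> 'a set \<Rightarrow> bool" where
  "compact_open_in X U \<longleftrightarrow> compactin X U \<and> openin X U"

definition compact_open_values :: "'a topology \<Rightarrow> 'a measure \<Rightarrow> real set" where
  "compact_open_values X M = {measure M U | U. compact_open_in X U \<and> emeasure M U < \<infinity>}"

text \<open>Goodness is a notion for measures on compact or non-compact locally compact Cantor
  sets; that the underlying space is one of these is not part of the predicate.\<close>

definition good_measure_on :: "'a topology \<Rightarrow> 'a measure \<Rightarrow> bool" where
  "good_measure_on Z M \<longleftrightarrow>
     borel_measure_on Z M \<and> finite_measure M \<and> full_measure_on Z M \<and> non_atomic M \<and>
     (\<forall>U V. compact_open_in Z U \<and> compact_open_in Z V \<and> emeasure M U < emeasure M V \<longrightarrow>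
        (\<exists>W. compact_open_in Z W \<and> W \<subseteq> V \<and> emeasure M W = emeasure M U))"

text \<open>The library's \<open>Alexandroff_compactification X\<close> has \<open>None\<close> as the added point and
  embeds \<open>X\<close> via \<open>Some\<close>. The push-forward along \<open>Some\<close> is the extension giving \<open>None\<close>
  measure zero; the lemmas below confirm this.\<close>

definition Alexandroff_extension :: "'a topology \<Rightarrow> 'a measure \<Rightarrow> 'a option measure" where
  "Alexandroff_extension X M =
     distr M (borel_space_of (Alexandroff_compactification X)) Some"

lemma space_borel_space_of: "space (borel_space_of X) = topspace X"
  unfolding borel_space_of_def by (rule space_measure_of) (auto dest: openin_subset)

lemma sets_borel_space_of:
  "sets (borel_space_of X) = sigma_sets (topspace X) {U. openin X U}"
  unfolding borel_space_of_def by (rule sets_measure_of) (auto dest: openin_subset)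

lemma borel_measure_on_Alexandroff_extension:
  "borel_measure_on (Alexandroff_compactification X) (Alexandroff_extension X M)"
  by (simp add: borel_measure_on_def Alexandroff_extension_def space_borel_space_of)

lemma Some_measurable_Alexandroff:
  assumes "borel_measure_on X M"
  shows "Some \<in> measurable M (borel_space_of (Alexandroff_compactification X))"
  unfolding borel_space_of_def
proof (rule measurable_measure_of)
  show "{U. openin (Alexandroff_compactification X) U}
      \<subseteq> Pow (topspace (Alexandroff_compactification X))"
    using openin_subset by blast
  show "Some \<in> space M \<rightarrow> topspace (Alexandroff_compactification X)"
    using assms by (auto simp: borel_measure_on_def)
  fix W assume "W \<in> {U. openin (Alexandroff_compactification X) U}"
  then have "openin (Alexandroff_compactification X) W" by simp
  then have "openin X (Some -` W \<inter> topspace X)"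
    using continuous_map_Some openin_continuous_map_preimage
    by (fastforce simp: vimage_def Int_def conj_commute)
  then show "Some -` W \<inter> space M \<in> sets M"
    using assms by (auto simp: borel_measure_on_def sets_borel_space_of)
qed

lemma Some_image_borel:
  assumes "A \<in> sets (borel_space_of X)"
  shows "Some ` A \<in> sets (borel_space_of (Alexandroff_compactification X))"
proof -
  let ?N = "borel_space_of (Alexandroff_compactification X)"
  have op: "Some ` U \<in> sets ?N" if "openin X U" for U
    using that by (auto simp: sets_borel_space_of openin_Alexandroff_compactification)
  have "A \<in> sigma_sets (topspace X) {U. openin X U}"
    using assms by (simp add: sets_borel_space_of)
  then show ?thesis
  proof induction
    case (Compl A)
    have "Some ` (topspace X - A) = Some ` topspace X - Some ` A" by auto
    then show ?case using Compl op[of "topspace X"] by auto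
  next
    case (Union A)
    then show ?case by (auto simp: image_UN)
  qed (use op in auto)
qed

lemma emeasure_Alexandroff_extension_Some:
  assumes "borel_measure_on X M" "A \<in> sets M"
  shows "emeasure (Alexandroff_extension X M) (Some ` A) = emeasure M A"
proof -
  have "Some -` Some ` A \<inter> space M = A"
    using sets.sets_into_space[OF assms(2)] by auto
  then show ?thesis
    using assms Some_image_borel[of A X] Some_measurable_Alexandroff[OF assms(1)]
    by (simp add: Alexandroff_extension_def emeasure_distr borel_measure_on_def)
qed

lemma emeasure_Alexandroff_extension_None:
  assumes "borel_measure_on X M"
  shows "{None} \<in> sets (Alexandroff_extension X M)"
    and "emeasure (Alexandroff_extension X M) {None} = 0"
proof -
  let ?N = "borel_space_of (Alexandroff_compactification X)"
  have "Some ` topspace X \<in> sets ?N"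
    by (rule Some_image_borel) (auto simp: sets_borel_space_of)
  then have "space ?N - Some ` topspace X \<in> sets ?N" by auto
  moreover have "space ?N - Some ` topspace X = {None}"
    by (auto simp: space_borel_space_of)
  ultimately have *: "{None} \<in> sets ?N" by simp
  then show "{None} \<in> sets (Alexandroff_extension X M)"
    by (simp add: Alexandroff_extension_def)
  have "Some -` {None} \<inter> space M = {}" by auto
  then show "emeasure (Alexandroff_extension X M) {None} = 0"
    using * Some_measurable_Alexandroff[OF assms]
    by (simp add: Alexandroff_extension_def emeasure_distr)
qed

end

theory Submission
  imports Defs
begin

text \<open>
  Exhausting \<open>X\<close> by compact open sets shows that the value set \<open>S\<close> of \<open>\<mu>\<close> accumulates at its
  supremum 1 without attaining it; goodness makes \<open>S\<close> closed under nonnegative differences and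
  under sums below 1. Reducing modulo a small element of \<open>S\<close> then gives \<open>S = G(S) \<inter> [0,1)\<close>.
  The compact open sets of the compactification have measure \<open>s\<close> or \<open>1 - s\<close> with \<open>s \<in> S\<close>. If
  \<open>1 \<in> G(S)\<close>, all these values below 1 lie in \<open>S\<close>, and goodness carries over. Conversely, a
  goodness comparison of a small neighbourhood of the added point with a compact open subset
  of \<open>X\<close> yields \<open>1 - s = s'\<close>.
\<close>

section \<open>Atoms of push-forwards; compact open sets of the compactification\<close>

text \<open>By injectivity the image of a measurable subset \<open>B\<close> of the preimage pulls
  back to \<open>B\<close> itself, so it has the measure of \<open>B\<close> and can be tested
  against the atom \<open>A\<close>. This later carries non-atomicity over to the extension.\<close>

lemma measure_atom_distr:
  assumes f: "f \<in> measurable M N" and "inj_on f (space M)"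
    and im: "\<And>B. B \<in> sets M \<Longrightarrow> f ` B \<in> sets N"
    and atom: "measure_atom (distr M N f) A"
  shows "measure_atom M (f -` A \<inter> space M)"
proof -
  have A: "A \<in> sets N" "emeasure M (f -` A \<inter> space M) > 0"
    using atom f by (auto simp: measure_atom_def emeasure_distr)
  have "emeasure M B = 0"
    if B: "B \<in> sets M" "B \<subseteq> f -` A \<inter> space M"
      and less: "emeasure M B < emeasure M (f -` A \<inter> space M)" for B
  proof -
    have "f -` f ` B \<inter> space M = B"
      using B(2) \<open>inj_on f (space M)\<close> by (auto simp: inj_on_def)
    then have "emeasure (distr M N f) (f ` B) = emeasure M B"
      using f im[OF B(1)] by (simp add: emeasure_distr)
    moreover have "emeasure (distr M N f) A = emeasure M (f -` A \<inter> space M)"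
      using f A by (simp add: emeasure_distr)
    ultimately show ?thesis
      using atom im[OF B(1)] B(2) less by (auto simp: measure_atom_def)
  qed
  then show ?thesis
    using A f by (auto simp: measure_atom_def)
qed

lemma compact_open_in_empty: "compact_open_in X {}"
  by (simp add: compact_open_in_def)

lemma compact_open_in_Un:
  "compact_open_in X U \<Longrightarrow> compact_open_in X V \<Longrightarrow> compact_open_in X (U \<union> V)"
  by (auto simp: compact_open_in_def intro: compactin_Un)

lemma compact_open_in_Diff:
  assumes "Hausdorff_space X" "compact_open_in X U" "compact_open_in X V"
  shows "compact_open_in X (U - V)"
proof -
  have "closedin X U" "closedin X V"
    using assms by (auto simp: compact_open_in_def compactin_imp_closedin)
  then show ?thesis
    using assms by (auto simp: compact_open_in_def intro: closed_compactin)
qed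

text \<open>In the compact Hausdorff compactification, compact open means clopen, and
  complementation exchanges the two kinds of sets on the right-hand side.\<close>

lemma compact_open_in_Alexandroff_iff:
  assumes "Hausdorff_space X" "locally_compact_space X"
  shows "compact_open_in (Alexandroff_compactification X) Z \<longleftrightarrow>
    (\<exists>U. compact_open_in X U \<and>
       (Z = Some ` U \<or> Z = insert None (Some ` (topspace X - U))))" (is "?L \<longleftrightarrow> ?R")
proof -
  let ?Y = "Alexandroff_compactification X"
  have "Hausdorff_space ?Y"
    using assms by (simp add: Hausdorff_space_Alexandroff_compactification)
  then have co: "compact_open_in ?Y Z \<longleftrightarrow> closedin ?Y Z \<and> openin ?Y Z"
    by (auto simp: compact_open_in_def compactin_imp_closedin closedin_compact_space)
  have compl: "topspace ?Y - insert None (Some ` (topspace X - C)) = Some ` C"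
    if "C \<subseteq> topspace X" for C
    using that by auto
  show ?thesis
  proof
    assume ?L
    then have Z: "closedin ?Y Z" "openin ?Y Z"
      using co by auto
    from Z(2) consider U where "openin X U" "Z = Some ` U"
      | C where "compactin X C" "closedin X C" "Z = insert None (Some ` (topspace X - C))"
      by (auto simp: openin_Alexandroff_compactification)
    then show ?R
    proof cases
      case 1
      then show ?thesis using Z by (auto simp: compact_open_in_def)
    next
      case 2
      then have "openin ?Y (Some ` C)"
        using Z(1) compl[of C] closedin_subset[of X C] by (metis closedin_def)
      then have "compact_open_in X C"
        using 2 by (simp add: compact_open_in_def)
      then show ?thesis using 2 by blast
    qed
  next
    assume ?R
    then obtain U where U: "compactin X U" "openin X U" "closedin X U"
      and "Z = Some ` U \<or> Z = insert None (Some ` (topspace X - U))"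
      using assms by (auto simp: compact_open_in_def compactin_imp_closedin)
    moreover have "closedin ?Y (insert None (Some ` (topspace X - U)))"
      using compl[of U] U by (auto simp: closedin_def openin_subset)
    moreover have "openin ?Y (insert None (Some ` (topspace X - U)))"
      using U by (auto simp: openin_Alexandroff_compactification)
    ultimately show ?L
      using co by auto
  qed
qed

section \<open>Exhausting the space by compact open sets\<close>

locale good_probability_lc_cantor = prob_space \<mu> for \<mu> :: "'a measure" +
  fixes X :: "'a topology"
  assumes noncompact_lc_cantor: "noncompact_lc_cantor X"
    and good: "good_measure_on X \<mu>"
begin

abbreviation "S \<equiv> compact_open_values X \<mu>"

abbreviation "\<omega>X \<equiv> Alexandroff_compactification X"

abbreviation "\<omega>\<mu> \<equiv> Alexandroff_extension X \<mu>"

lemma Hausdorff: "Hausdorff_space X"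
  using noncompact_lc_cantor metrizable_imp_Hausdorff_space
  by (auto simp: noncompact_lc_cantor_def)

lemma borel: "borel_measure_on X \<mu>"
  using good by (simp add: good_measure_on_def)

lemma space_eq: "space \<mu> = topspace X"
  using borel by (simp add: borel_measure_on_def)

lemma openin_sets: "openin X U \<Longrightarrow> U \<in> sets \<mu>"
  using borel by (auto simp: borel_measure_on_def sets_borel_space_of)

lemma compact_open_sets: "compact_open_in X U \<Longrightarrow> U \<in> sets \<mu>"
  by (simp add: compact_open_in_def openin_sets)

lemma compact_open_subset: "compact_open_in X U \<Longrightarrow> U \<subseteq> topspace X"
  by (simp add: compact_open_in_def openin_subset)

lemma measure_openin_pos: "openin X U \<Longrightarrow> U \<noteq> {} \<Longrightarrow> 0 < prob U"
  using good
  by (auto simp: good_measure_on_def full_measure_on_def emeasure_eq_measure)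

lemma values_iff: "s \<in> S \<longleftrightarrow> (\<exists>U. compact_open_in X U \<and> prob U = s)"
  by (auto simp: compact_open_values_def emeasure_eq_measure)

text \<open>Since \<open>X\<close> is not compact, the complement of \<open>U\<close> is non-empty;
  it is also open, so fullness gives it positive measure.\<close>

lemma measure_compact_open_less_1:
  assumes "compact_open_in X U"
  shows "prob U < 1"
proof -
  have "U \<noteq> topspace X"
    using assms noncompact_lc_cantor
    by (auto simp: compact_open_in_def noncompact_lc_cantor_def compact_space_def)
  moreover have "openin X (topspace X - U)"
    using assms Hausdorff by (auto simp: compact_open_in_def compactin_imp_closedin)
  ultimately have "0 < prob (space \<mu> - U)"
    using measure_openin_pos compact_open_subset[OF assms] space_eq by auto
  then show ?thesis
    using prob_compl[OF compact_open_sets[OF assms]] by simp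
qed

text \<open>Finite unions of members of the countable base increase to the whole space, so
  continuity from below drives their measures to 1.\<close>

lemma compact_open_exhaust:
  assumes "compact_open_in X K" "c < 1"
  obtains K' where "compact_open_in X K'" "K \<subseteq> K'" "c < prob K'"
proof -
  obtain \<B> where \<B>: "countable \<B>" "\<And>V. V \<in> \<B> \<Longrightarrow> compact_open_in X V"
    "\<And>x. x \<in> topspace X \<Longrightarrow> \<exists>V\<in>\<B>. x \<in> V"
    using noncompact_lc_cantor unfolding noncompact_lc_cantor_def compact_open_in_def
    by (metis openin_topspace)
  \<comment> \<open>Inserting \<open>K\<close> makes the family non-empty, so that
    \<open>from_nat_into\<close> enumerates exactly its members.\<close>
  let ?B = "from_nat_into (insert K \<B>)"
  define A where "A n = K \<union> (\<Union>i\<le>n. ?B i)" for n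
  have B: "compact_open_in X (?B i)" for i
    using from_nat_into[of "insert K \<B>" i] \<B>(2) assms(1) by auto
  have "compact_open_in X (\<Union>i\<le>n. ?B i)" for n
    by (induction n) (auto simp: atMost_Suc intro: compact_open_in_Un B)
  then have co: "compact_open_in X (A n)" for n
    unfolding A_def by (intro compact_open_in_Un assms(1))
  have range: "range ?B = insert K \<B>"
    using \<B>(1) by simp
  have "x \<in> (\<Union>n. A n)" if x: "x \<in> topspace X" for x
  proof -
    obtain i where "x \<in> ?B i"
      using \<B>(3)[OF x] range by (metis imageE insertCI)
    then show ?thesis
      by (auto simp: A_def)
  qed
  moreover have "A n \<subseteq> topspace X" for n
    by (rule compact_open_subset[OF co])
  ultimately have "(\<Union>n. A n) = space \<mu>"
    unfolding space_eq by blast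
  moreover have "incseq A"
    unfolding A_def incseq_def by force
  ultimately have "(\<lambda>n. prob (A n)) \<longlonglongrightarrow> 1"
    using finite_Lim_measure_incseq[of A] compact_open_sets[OF co]
    by (simp add: image_subset_iff prob_space)
  then have "eventually (\<lambda>n. c < prob (A n)) sequentially"
    using assms(2) by (rule order_tendstoD)
  then obtain n where "c < prob (A n)"
    by (auto simp: eventually_sequentially)
  then show ?thesis
    using that co by (auto simp: A_def)
qed

section \<open>Arithmetic of the value set\<close>

lemma goodD:
  assumes "compact_open_in X V" "s \<in> S" "s < prob V"
  obtains W where "compact_open_in X W" "W \<subseteq> V" "prob W = s"
proof -
  obtain U where U: "compact_open_in X U" "prob U = s"
    using assms(2) by (auto simp: values_iff)
  have "emeasure \<mu> U < emeasure \<mu> V"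
    using assms(3) by (simp add: emeasure_eq_measure ennreal_less_iff flip: U(2))
  then obtain W where "compact_open_in X W" "W \<subseteq> V" "emeasure \<mu> W = emeasure \<mu> U"
    using good U(1) assms(1) unfolding good_measure_on_def by blast
  then show ?thesis
    using that[of W] by (simp add: emeasure_eq_measure flip: U(2))
qed

lemma zero_in_values: "0 \<in> S"
  unfolding values_iff using compact_open_in_empty by (intro exI[of _ "{}"]) auto

lemma values_bounds: "s \<in> S \<Longrightarrow> 0 \<le> s \<and> s < 1"
  using measure_compact_open_less_1 by (auto simp: values_iff)

lemma values_Diff:
  assumes "compact_open_in X U" "compact_open_in X V" "U \<subseteq> V"
  shows "prob V - prob U \<in> S"
  using assms compact_open_in_Diff[OF Hausdorff assms(2,1)]
    finite_measure_Diff[OF compact_open_sets compact_open_sets]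
  by (auto simp: values_iff)

text \<open>Goodness places a set of measure \<open>s\<close> inside one of measure
  \<open>t\<close>, and the difference set has the required value. Equality is treated apart because
  goodness needs a strict inequality.\<close>

lemma values_diff:
  assumes "s \<in> S" "t \<in> S" "s \<le> t"
  shows "t - s \<in> S"
proof (cases "s = t")
  case False
  obtain V where "compact_open_in X V" "prob V = t"
    using assms by (auto simp: values_iff)
  then show ?thesis
    using goodD[of V s] values_Diff assms False by (metis order_less_le)
qed (simp add: zero_in_values)

text \<open>Enlarging \<open>K\<close> to a compact open \<open>K'\<close> leaves more than
  \<open>s\<close> of free measure in \<open>K' - K\<close>, where goodness then applies.\<close>

lemma good_outside:
  assumes "compact_open_in X K" "s \<in> S" "s + prob K < 1"
  obtains W where "compact_open_in X W" "W \<inter> K = {}" "prob W = s"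
proof -
  obtain K' where K': "compact_open_in X K'" "K \<subseteq> K'" "s + prob K < prob K'"
    using compact_open_exhaust assms by metis
  have "prob (K' - K) = prob K' - prob K"
    using K' assms by (intro finite_measure_Diff compact_open_sets)
  then obtain W where "compact_open_in X W" "W \<subseteq> K' - K" "prob W = s"
    using goodD[of "K' - K" s] compact_open_in_Diff[OF Hausdorff K'(1) assms(1)] K'(3) assms(2)
    by auto
  then show ?thesis
    using that by blast
qed

lemma values_add:
  assumes "s \<in> S" "t \<in> S" "s + t < 1"
  shows "s + t \<in> S"
proof -
  obtain U where U: "compact_open_in X U" "prob U = t"
    using assms by (auto simp: values_iff)
  then obtain W where W: "compact_open_in X W" "W \<inter> U = {}" "prob W = s"
    using good_outside[of U s] assms by auto
  then have "prob (W \<union> U) = s + t"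
    using U by (simp add: finite_measure_Union compact_open_sets)
  then show ?thesis
    using compact_open_in_Un[OF W(1) U(1)] by (auto simp: values_iff)
qed

text \<open>The value 1 is approached but never attained: above a set of measure greater than
  \<open>1 - e\<close> lies a strictly larger one, and the two values differ by less than
  \<open>e\<close>.\<close>

lemma values_arbitrarily_small:
  assumes "0 < e"
  obtains d where "d \<in> S" "0 < d" "d < e"
proof -
  have "1 - e < 1"
    using assms by simp
  then obtain K where K: "compact_open_in X K" "1 - e < prob K"
    using compact_open_exhaust[OF compact_open_in_empty] by metis
  obtain K' where K': "compact_open_in X K'" "K \<subseteq> K'" "prob K < prob K'"
    using compact_open_exhaust[OF K(1) measure_compact_open_less_1[OF K(1)]] by metis
  show ?thesis
    using that[of "prob K' - prob K"] values_Diff[OF K(1) K'(1,2)] K K'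
      measure_compact_open_less_1[OF K'(1)] by simp
qed

section \<open>The value set as the part of its group in the unit interval\<close>

text \<open>Division with remainder: \<open>d\<close> is subtracted
  \<open>\<lfloor>s / d\<rfloor>\<close> times, and every intermediate difference is non-negative
  and so stays in \<open>S\<close>.\<close>

lemma values_remainder:
  assumes "d \<in> S" "0 < d" "s \<in> S"
  shows "\<exists>r\<in>S. \<exists>k::int. r < d \<and> s = r + d * of_int k"
proof -
  have sub: "s - d * real n \<in> S" if "d * real n \<le> s" for n
    using that
  proof (induction n)
    case (Suc n)
    then show ?case
      using values_diff[of d "s - d * real n"] assms by (simp add: algebra_simps)
  qed (use assms in simp)
  have "0 \<le> \<lfloor>s / d\<rfloor>"
    using assms values_bounds by simp
  then obtain n where n: "\<lfloor>s / d\<rfloor> = int n"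
    by (rule zero_le_imp_eq_int[THEN exE])
  have "d * real n \<le> s" "s - d * real n < d"
    using floor_divide_lower[OF assms(2), of s] floor_divide_upper[OF assms(2), of s]
    by (simp_all add: n algebra_simps)
  moreover have "s = (s - d * real n) + d * of_int (int n)"
    by simp
  ultimately show ?thesis
    using sub by blast
qed

text \<open>Induction on the generation of the group by differences: remainders modulo
  \<open>d\<close> can be subtracted without leaving \<open>S\<close>.\<close>

lemma group_closure_remainder:
  assumes d: "d \<in> S" "0 < d" "2 * d < 1" and "g \<in> group_closure S"
  shows "\<exists>r\<in>S. \<exists>k::int. r < d \<and> g = r + d * of_int k"
  using assms(4)
proof induction
  case (base s)
  \<comment> \<open>The base rule of \<open>group_closure\<close> admits 0 besides the
    generators.\<close>
  then have "s \<in> S"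
    using zero_in_values by auto
  with d show ?case
    by (intro values_remainder)
next
  case (diff s t)
  then obtain a k b l where ab: "a \<in> S" "a < d" "b \<in> S" "b < d"
    and st: "s = a + d * of_int k" "t = b + d * of_int l"
    by blast
  show ?case
  proof (cases "b \<le> a")
    case True
    have "s - t = (a - b) + d * of_int (k - l)"
      by (simp add: st algebra_simps)
    moreover have "a - b \<in> S" "a - b < d"
      using values_diff[of b a] values_bounds[of b] ab True by auto
    ultimately show ?thesis by blast
  next
    case False
    \<comment> \<open>Here \<open>a - b\<close> is negative, so one \<open>d\<close> is borrowed
      from the multiple; \<open>a < b\<close> keeps the new remainder below
      \<open>d\<close>.\<close>
    have "s - t = (a + (d - b)) + d * of_int (k - l - 1)"
      by (simp add: st algebra_simps)
    moreover have "d - b \<in> S"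
      using values_diff[of b d] d ab by auto
    then have "a + (d - b) \<in> S" "a + (d - b) < d"
      using values_add[of a "d - b"] values_bounds[of b] ab d False by auto
    ultimately show ?thesis by blast
  qed
qed

text \<open>An element \<open>g\<close> of the group in \<open>[0,1)\<close> is a remainder in
  \<open>S\<close> plus a multiple of a small \<open>d\<close>; adding \<open>d\<close> repeatedly
  reaches \<open>g\<close> through partial sums below 1, all of which lie in
  \<open>S\<close>.\<close>

lemma values_eq_group_closure: "S = group_closure S \<inter> {0..<1}"
proof -
  have "g \<in> S" if g: "g \<in> group_closure S" "0 \<le> g" "g < 1" for g
  proof -
    obtain d where "d \<in> S" "0 < d" "d < 1 / 2"
      by (rule values_arbitrarily_small[of "1 / 2"]) simp
    then have d: "d \<in> S" "0 < d" "2 * d < 1"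
      by simp_all
    obtain r k where r: "r \<in> S" "r < d" and g_eq: "g = r + d * of_int k"
      using group_closure_remainder[OF d g(1)] by blast
    have add: "r + d * real n \<in> S" if "r + d * real n < 1" for n
      using that
    proof (induction n)
      case (Suc n)
      then show ?case
        using values_add[OF _ d(1), of "r + d * real n"] d by (simp add: algebra_simps)
    qed (use r in simp)
    \<comment> \<open>From \<open>0 \<le> g\<close> and \<open>r < d\<close> it follows that
      \<open>k > -1\<close>, hence the integer \<open>k\<close> is non-negative.\<close>
    have "0 < d * of_int (k + 1)"
      using g r g_eq by (simp add: algebra_simps)
    then have "0 \<le> k"
      using d by (simp add: zero_less_mult_iff)
    then obtain n where "k = int n"
      by (rule zero_le_imp_eq_int[THEN exE])
    then show ?thesis
      using add[of n] g g_eq by simp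
  qed
  then show ?thesis
    using values_bounds by (auto intro: group_closure.base)
qed

section \<open>The extended measure on the compactification\<close>

lemma compact_open_in_extension_iff:
  "compact_open_in \<omega>X Z \<longleftrightarrow> (\<exists>U. compact_open_in X U \<and>
       (Z = Some ` U \<or> Z = insert None (Some ` (topspace X - U))))"
  using compact_open_in_Alexandroff_iff[OF Hausdorff] noncompact_lc_cantor
  by (simp add: noncompact_lc_cantor_def)

lemma prob_space_extension: "prob_space \<omega>\<mu>"
  unfolding Alexandroff_extension_def
  by (rule prob_space_distr) (rule Some_measurable_Alexandroff[OF borel])

lemma emeasure_extension:
  assumes "Z \<in> sets \<omega>\<mu>"
  shows "emeasure \<omega>\<mu> Z = ennreal (prob {x \<in> topspace X. Some x \<in> Z})"
proof -
  have "Some -` Z \<inter> space \<mu> = {x \<in> topspace X. Some x \<in> Z}"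
    using space_eq by auto
  then show ?thesis
    using assms Some_measurable_Alexandroff[OF borel]
    by (simp add: Alexandroff_extension_def emeasure_distr emeasure_eq_measure)
qed

lemma openin_extension_sets: "openin \<omega>X Z \<Longrightarrow> Z \<in> sets \<omega>\<mu>"
  using borel_measure_on_Alexandroff_extension[of X \<mu>]
  by (auto simp: borel_measure_on_def sets_borel_space_of)

lemma emeasure_extension_Some:
  assumes "compact_open_in X U"
  shows "emeasure \<omega>\<mu> (Some ` U) = ennreal (prob U)"
  using emeasure_Alexandroff_extension_Some[OF borel compact_open_sets[OF assms]]
  by (simp add: emeasure_eq_measure)

lemma emeasure_extension_None:
  assumes "compact_open_in X U"
  shows "emeasure \<omega>\<mu> (insert None (Some ` (topspace X - U))) = ennreal (1 - prob U)"
proof -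
  let ?Z = "insert None (Some ` (topspace X - U))"
  have "compact_open_in \<omega>X ?Z"
    using assms compact_open_in_extension_iff by blast
  then have "?Z \<in> sets \<omega>\<mu>"
    by (simp add: compact_open_in_def openin_extension_sets)
  moreover have "{x \<in> topspace X. Some x \<in> ?Z} = space \<mu> - U"
    by (auto simp: space_eq)
  ultimately show ?thesis
    using emeasure_extension[of ?Z] prob_compl[OF compact_open_sets[OF assms]] by simp
qed

text \<open>The trace on \<open>X\<close> of a non-empty open set is open, and it is non-empty
  because the added point is not isolated, \<open>X\<close> being non-compact.\<close>

lemma full_measure_on_extension: "full_measure_on \<omega>X \<omega>\<mu>"
  unfolding full_measure_on_def
proof (intro allI impI)
  fix Z assume Z: "openin \<omega>X Z \<and> Z \<noteq> {}"
  have "openin X {x \<in> topspace X. Some x \<in> Z}"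
    using Z openin_continuous_map_preimage[OF continuous_map_Some] by blast
  moreover have "{x \<in> topspace X. Some x \<in> Z} \<noteq> {}"
  proof -
    consider U where "openin X U" "Z = Some ` U"
      | C where "compactin X C" "closedin X C" "Z = insert None (Some ` (topspace X - C))"
      using Z by (auto simp: openin_Alexandroff_compactification)
    then show ?thesis
    proof cases
      case 1
      then show ?thesis using Z openin_subset by fastforce
    next
      case 2
      then have "C \<noteq> topspace X"
        using noncompact_lc_cantor by (auto simp: noncompact_lc_cantor_def compact_space_def)
      then show ?thesis using 2 closedin_subset by fastforce
    qed
  qed
  ultimately have "0 < prob {x \<in> topspace X. Some x \<in> Z}"
    by (rule measure_openin_pos)
  then show "0 < emeasure \<omega>\<mu> Z"
    using Z by (simp add: emeasure_extension openin_extension_sets)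
qed

lemma non_atomic_extension: "non_atomic \<omega>\<mu>"
proof -
  have "measure_atom \<mu> (Some -` A \<inter> space \<mu>)" if "measure_atom \<omega>\<mu> A" for A
    using that borel unfolding Alexandroff_extension_def
    by (intro measure_atom_distr[OF Some_measurable_Alexandroff[OF borel]])
      (auto simp: borel_measure_on_def intro: Some_image_borel)
  then show ?thesis
    using good by (auto simp: good_measure_on_def non_atomic_def)
qed

text \<open>The other requirements of goodness always hold for the extension, which leaves only the
  comparison of compact open sets.\<close>

lemma good_measure_on_extension_iff:
  "good_measure_on \<omega>X \<omega>\<mu> \<longleftrightarrow>
    (\<forall>U V. compact_open_in \<omega>X U \<and> compact_open_in \<omega>X V \<and> emeasure \<omega>\<mu> U < emeasure \<omega>\<mu> V \<longrightarrow>
        (\<exists>W. compact_open_in \<omega>X W \<and> W \<subseteq> V \<and> emeasure \<omega>\<mu> W = emeasure \<omega>\<mu> U))"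
  unfolding good_measure_on_def
  using borel_measure_on_Alexandroff_extension prob_space_extension full_measure_on_extension
    non_atomic_extension prob_space.finite_measure by blast

section \<open>The two implications\<close>

lemma one_in_group_closure_if_good:
  assumes "good_measure_on \<omega>X \<omega>\<mu>"
  shows "1 \<in> group_closure S"
proof -
  obtain K where K: "compact_open_in X K" "0 < prob K"
    using compact_open_exhaust[OF compact_open_in_empty, of 0] by auto
  then have "1 - prob K < 1" by simp
  \<comment> \<open>\<open>L\<close> is so large that its complement, a neighbourhood
    \<open>?N\<close> of the added point, has smaller measure than \<open>K\<close>.\<close>
  then obtain L where L: "compact_open_in X L" "1 - prob K < prob L"
    using compact_open_exhaust[OF compact_open_in_empty] by metis
  let ?N = "insert None (Some ` (topspace X - L))"
  have "compact_open_in \<omega>X ?N" "compact_open_in \<omega>X (Some ` K)"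
    using K L compact_open_in_extension_iff by blast+
  moreover have "emeasure \<omega>\<mu> ?N < emeasure \<omega>\<mu> (Some ` K)"
    using K L by (simp add: emeasure_extension_None emeasure_extension_Some ennreal_less_iff)
  ultimately obtain W where W: "compact_open_in \<omega>X W" "W \<subseteq> Some ` K"
      "emeasure \<omega>\<mu> W = emeasure \<omega>\<mu> ?N"
    using assms unfolding good_measure_on_extension_iff by metis
  \<comment> \<open>Lying inside the \<open>Some\<close> image of \<open>K\<close>, the set
    \<open>W\<close> omits \<open>None\<close>, so it comes from a compact open subset of
    \<open>X\<close>.\<close>
  then obtain U where U: "compact_open_in X U" "W = Some ` U"
    by (auto simp: compact_open_in_extension_iff)
  then have "prob U = 1 - prob L"
    using W L by (simp add: emeasure_extension_None emeasure_extension_Some)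
  then have "1 = prob U + prob L" by simp
  moreover have "prob U \<in> group_closure S" "prob L \<in> group_closure S"
    using U L by (auto simp: values_iff intro!: group_closure.base)
  ultimately show ?thesis
    using group_closure_add by metis
qed

text \<open>With 1 in the group, the value of every compact open set of \<open>\<omega>X\<close>
  lies in it. The smaller of two values is below 1, so it belongs to \<open>S\<close> and is
  realised by a compact open subset of \<open>X\<close> that fits inside the larger set.\<close>

lemma good_if_one_in_group_closure:
  assumes "1 \<in> group_closure S"
  shows "good_measure_on \<omega>X \<omega>\<mu>"
  unfolding good_measure_on_extension_iff
proof (intro allI impI)
  fix U V
  assume "compact_open_in \<omega>X U \<and> compact_open_in \<omega>X V \<and> emeasure \<omega>\<mu> U < emeasure \<omega>\<mu> V"
  then have U: "compact_open_in \<omega>X U" and V: "compact_open_in \<omega>X V"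
    and less: "emeasure \<omega>\<mu> U < emeasure \<omega>\<mu> V"
    by simp_all
  have val: "\<exists>r. emeasure \<omega>\<mu> Z = ennreal r \<and> r \<in> group_closure S \<and> 0 \<le> r \<and> r \<le> 1"
    if Z: "compact_open_in \<omega>X Z" for Z
  proof -
    obtain K where K: "compact_open_in X K"
      "Z = Some ` K \<or> Z = insert None (Some ` (topspace X - K))"
      using Z unfolding compact_open_in_extension_iff by blast
    then have "prob K \<in> group_closure S"
      by (auto simp: values_iff intro!: group_closure.base)
    moreover from this have "1 - prob K \<in> group_closure S"
      by (intro group_closure.diff assms)
    moreover have "emeasure \<omega>\<mu> Z = ennreal (prob K) \<or> emeasure \<omega>\<mu> Z = ennreal (1 - prob K)"
      using K emeasure_extension_Some emeasure_extension_None by metis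
    moreover have "0 \<le> prob K" "prob K \<le> 1" "0 \<le> 1 - prob K" "1 - prob K \<le> 1"
      by simp_all
    ultimately show ?thesis
      by metis
  qed
  obtain r where r: "emeasure \<omega>\<mu> U = ennreal r" "r \<in> group_closure S" "0 \<le> r"
    using val[OF U] by blast
  obtain t where t: "emeasure \<omega>\<mu> V = ennreal t" "t \<le> 1" "0 \<le> t"
    using val[OF V] by blast
  have "r < t"
    using less r t by (simp add: ennreal_less_iff)
  then have "r \<in> S"
    using r t by (subst values_eq_group_closure) simp
  obtain K where K: "compact_open_in X K"
    and V_cases: "V = Some ` K \<or> V = insert None (Some ` (topspace X - K))"
    using V unfolding compact_open_in_extension_iff by blast
  have "\<exists>W. compact_open_in X W \<and> Some ` W \<subseteq> V \<and> prob W = r"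
    using V_cases
  proof
    assume "V = Some ` K"
    moreover from this have "r < prob K"
      using K t \<open>r < t\<close> by (simp add: emeasure_extension_Some)
    ultimately show ?thesis
      using goodD[OF K \<open>r \<in> S\<close>] by (metis image_mono)
  next
    assume V_eq: "V = insert None (Some ` (topspace X - K))"
    \<comment> \<open>Here \<open>t = 1 - prob K\<close>, so a set of measure \<open>r\<close> fits
      outside \<open>K\<close>.\<close>
    then have "r + prob K < 1"
      using K t \<open>r < t\<close> by (simp add: emeasure_extension_None)
    then obtain W where "compact_open_in X W" "W \<inter> K = {}" "prob W = r"
      using good_outside[OF K \<open>r \<in> S\<close>] by metis
    then show ?thesis
      using V_eq compact_open_subset by blast
  qed
  then obtain W where "compact_open_in X W" "Some ` W \<subseteq> V" "prob W = r"
    by blast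
  then have "compact_open_in \<omega>X (Some ` W) \<and> Some ` W \<subseteq> V \<and>
      emeasure \<omega>\<mu> (Some ` W) = emeasure \<omega>\<mu> U"
    using r(1) emeasure_extension_Some unfolding compact_open_in_extension_iff by auto
  then show "\<exists>W. compact_open_in \<omega>X W \<and> W \<subseteq> V \<and> emeasure \<omega>\<mu> W = emeasure \<omega>\<mu> U"
    by blast
qed

end

theorem theorem3p9:
  fixes X :: "'a topology" and \<mu> :: "'a measure"
  assumes "noncompact_lc_cantor X"
    and "good_measure_on X \<mu>"
    and "prob_space \<mu>"
  shows "good_measure_on (Alexandroff_compactification X) (Alexandroff_extension X \<mu>)
           \<longleftrightarrow> 1 \<in> group_closure (compact_open_values X \<mu>)"
proof -
  interpret good_probability_lc_cantor \<mu> X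
    using assms by (simp add: good_probability_lc_cantor_def good_probability_lc_cantor_axioms_def)
  show ?thesis
    using one_in_group_closure_if_good good_if_one_in_group_closure by blast
qed

end
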